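(* Let $f_{\delta,M}$ be the piecewise-linear approximation, built from $M$ samples $\mathbf{Y}_1,\dots,\mathbf{Y}_M\in\Gamma$ and a subdivision $\mathcal{B}^\delta$ of $\Gamma$, given by $$f_{\delta,M}(\mathbf{Y})=\sum_{j=1}^{N_{nodes}}F_j\,\phi_j(\mathbf{Y}),\qquad F_j=\frac{1}{M C_j}\sum_{\mathbf{Y}_m\in S_j}\phi_j(\mathbf{Y}_m),\qquad C_j=\int_{S_j}\phi_j(\mathbf{Y})\,d\mathbf{Y},$$ where $\{\phi_j\}$ is the Lagrangian hat-function basis on $\mathcal{B}^\delta$ and $S_j$ is the support of $\phi_j$. Then $f_{\delta,M}(\mathbf{Y})\ge 0$ for all $\mathbf{Y}\in\Gamma$, and $\int_\Gamma f_{\delta,M}(\mathbf{Y})\,d\mathbf{Y}=1$.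
   Context: $\Gamma\subset\mathbb{R}^{N_\Gamma}$ is a closed, bounded polytope. $\mathcal{B}^\delta=\{\mathcal{B}_\ell\}_{\ell=1}^{N_{bins}}$ is a covering, non-overlapping subdivision of $\Gamma$ into hyper-quadrilateral bins (intervals if $N_\Gamma=1$, quadrilaterals if $N_\Gamma=2$, etc.) such that each face of a bin is either also a complete face of an abutting bin or part of the boundary of $\Gamma$; $\delta$ is the largest diameter of the bins. The nodes (vertices) of $\mathcal{B}^\delta$ are $\{\widehat{\mathbf{Y}}_j\}_{j=1}^{N_{nodes}}$. $\mathcal{V}_\delta$ is the space of functions continuous on $\Gamma$ whose restriction to each bin is $N_\Gamma$-linear (linear, bilinear, trilinear for $N_\Gamma=1,2,3$), in the usual finite element sense (for bins that are not axis-parallel boxes, $N_\Gamma$-linear after pull-back to the reference cube by the standard multilinear map). The basis $\{\phi_j\}_{j=1}^{N_{nodes}}$ of $\mathcal{V}_\delta$ is the Lagrangian (hat-function) basis: $\phi_j\in\mathcal{V}_\delta$ and $\phi_j(\widehat{\mathbf{Y}}_{j'})=\delta_{jj'}$ (Kronecker delta) for all $j,j'$. $S_j$ is the support of $\phi_j$, i.e. the union of the bins having $\widehat{\mathbf{Y}}_j$ as a vertex. $M\ge 1$ is the number of samples, and the samples $\mathbf{Y}_1,\dots,\mathbf{Y}_M$ are points of $\Gamma$. *)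

theory Defs
  imports "HOL-Analysis.Analysis"
begin

text \<open>
  The dimension is \<open>CARD('n)\<close> and the reference cube is \<^term>\<open>cbox 0 1 :: (real^'n) set\<close>. Its vertices
  are identified with the sets \<open>A :: 'n set\<close> of coordinates that are equal to 1, so the array of
  vertices of a bin is a function \<open>v :: 'n set \<Rightarrow> real^'n\<close>.
\<close>

text \<open>Polynomials of degree at most one in each variable separately (the finite element space Q1).\<close>

definition multilinear_poly :: "(real^'n \<Rightarrow> real) \<Rightarrow> bool" where
  "multilinear_poly q \<longleftrightarrow> (\<exists>c :: 'n set \<Rightarrow> real. \<forall>t. q t = (\<Sum>A\<in>UNIV. c A * (\<Prod>i\<in>A. t $ i)))"

text \<open>
  The standard multilinear map of the reference cube: it sends the cube vertex \<open>A\<close> to \<open>v A\<close> and is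
  of degree at most one in each variable.
\<close>

definition ref_map :: "('n set \<Rightarrow> real^'n) \<Rightarrow> real^'n \<Rightarrow> real^'n" where
  "ref_map v t = (\<Sum>A\<in>UNIV. ((\<Prod>i\<in>A. t $ i) * (\<Prod>i\<in>-A. 1 - t $ i)) *\<^sub>R v A)"

definition bin :: "('n set \<Rightarrow> real^'n) \<Rightarrow> (real^'n) set" where
  "bin v = ref_map v ` cbox 0 1"

text \<open>
  Injectivity is what makes the pull-back to the reference cube meaningful. For \<open>CARD('n) = 2\<close> it
  excludes non-convex and self-intersecting quadrilaterals; for \<open>CARD('n) \<ge> 3\<close> the faces are
  allowed, but not required, to be planar.
\<close>

definition hyper_quadrilateral :: "('n set \<Rightarrow> real^'n) \<Rightarrow> bool" where
  "hyper_quadrilateral v \<longleftrightarrow> inj_on (ref_map v) (cbox 0 1)"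

text \<open>The faces of codimension one.\<close>

definition bin_faces :: "('n set \<Rightarrow> real^'n) \<Rightarrow> (real^'n) set set" where
  "bin_faces v = {ref_map v ` {t \<in> cbox 0 1. t $ i = e} | i e. e \<in> {0, 1}}"

definition bin_subdivision :: "(real^'n) set \<Rightarrow> nat \<Rightarrow> (nat \<Rightarrow> 'n set \<Rightarrow> real^'n) \<Rightarrow> bool" where
  "bin_subdivision \<Gamma> Nbins B \<longleftrightarrow>
     (\<forall>l\<in>{1..Nbins}. hyper_quadrilateral (B l)) \<and>
     (\<Union>l\<in>{1..Nbins}. bin (B l)) = \<Gamma> \<and>
     (\<forall>l\<in>{1..Nbins}. \<forall>l'\<in>{1..Nbins}. l \<noteq> l' \<longrightarrow>
        interior (bin (B l)) \<inter> interior (bin (B l')) = {}) \<and>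
     (\<forall>l\<in>{1..Nbins}. \<forall>F\<in>bin_faces (B l).
        F \<subseteq> frontier \<Gamma> \<or> (\<exists>l'\<in>{1..Nbins}. l' \<noteq> l \<and> F \<in> bin_faces (B l')))"

definition nodes :: "nat \<Rightarrow> (nat \<Rightarrow> 'n set \<Rightarrow> real^'n) \<Rightarrow> (real^'n) set" where
  "nodes Nbins B = (\<Union>l\<in>{1..Nbins}. range (B l))"

text \<open>Only the values on \<open>\<Gamma>\<close> matter; members are unconstrained outside \<open>\<Gamma>\<close>.\<close>

definition fe_space ::
  "(real^'n) set \<Rightarrow> nat \<Rightarrow> (nat \<Rightarrow> 'n set \<Rightarrow> real^'n) \<Rightarrow> (real^'n \<Rightarrow> real) set" where
  "fe_space \<Gamma> Nbins B = {f. continuous_on \<Gamma> f \<and>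
     (\<forall>l\<in>{1..Nbins}. \<exists>q. multilinear_poly q \<and> (\<forall>t\<in>cbox 0 1. f (ref_map (B l) t) = q t))}"

definition lagrangian_basis ::
  "(real^'n) set \<Rightarrow> nat \<Rightarrow> (nat \<Rightarrow> 'n set \<Rightarrow> real^'n) \<Rightarrow> nat \<Rightarrow> (nat \<Rightarrow> real^'n) \<Rightarrow>
     (nat \<Rightarrow> real^'n \<Rightarrow> real) \<Rightarrow> bool" where
  "lagrangian_basis \<Gamma> Nbins B Nnodes Yhat \<phi> \<longleftrightarrow>
     (\<forall>j\<in>{1..Nnodes}. \<phi> j \<in> fe_space \<Gamma> Nbins B \<and>
        (\<forall>j'\<in>{1..Nnodes}. \<phi> j (Yhat j') = (if j = j' then 1 else 0)))"

definition supp :: "(real^'n) set \<Rightarrow> (real^'n \<Rightarrow> real) \<Rightarrow> (real^'n) set" where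
  "supp \<Gamma> f = closure {y \<in> \<Gamma>. f y \<noteq> 0}"

definition C_coeff :: "(real^'n) set \<Rightarrow> (nat \<Rightarrow> real^'n \<Rightarrow> real) \<Rightarrow> nat \<Rightarrow> real" where
  "C_coeff \<Gamma> \<phi> j = (LINT y:supp \<Gamma> (\<phi> j)|lborel. \<phi> j y)"

definition F_coeff ::
  "(real^'n) set \<Rightarrow> (nat \<Rightarrow> real^'n \<Rightarrow> real) \<Rightarrow> nat \<Rightarrow> (nat \<Rightarrow> real^'n) \<Rightarrow> nat \<Rightarrow> real" where
  "F_coeff \<Gamma> \<phi> M Y j =
     1 / (real M * C_coeff \<Gamma> \<phi> j) * (\<Sum>m | m \<in> {1..M} \<and> Y m \<in> supp \<Gamma> (\<phi> j). \<phi> j (Y m))"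

definition f_approx ::
  "(real^'n) set \<Rightarrow> nat \<Rightarrow> (nat \<Rightarrow> real^'n \<Rightarrow> real) \<Rightarrow> nat \<Rightarrow> (nat \<Rightarrow> real^'n) \<Rightarrow> real^'n \<Rightarrow> real" where
  "f_approx \<Gamma> Nnodes \<phi> M Y y = (\<Sum>j\<in>{1..Nnodes}. F_coeff \<Gamma> \<phi> M Y j * \<phi> j y)"

end

theory Submission
  imports Defs
begin

text \<open>
  On one bin, a function of the finite element space is the pull-back of a multilinear polynomial
  \<open>q\<close>, and such a polynomial is the combination of its values at the cube vertices with the weights
  \<open>vertex_weight A\<close> (\<open>multilinear_poly_interpolation\<close>). These weights are nonnegative on the cube
  and sum to one, so nonnegativity of a member of the space, and affine relations between members,
  carry over from the nodes to all of \<open>\<Gamma>\<close> (\<open>fe_space_eq_vertex_combination\<close>). Hence the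
  hat functions are nonnegative and sum to one on \<open>\<Gamma>\<close>.

  Since \<open>\<phi> j\<close> vanishes in \<open>\<Gamma>\<close> off its support, \<open>C_coeff \<Gamma> \<phi> j\<close> is \<open>\<integral>\<^sub>\<Gamma> \<phi> j\<close>. It is positive:
  a bin is the image of the cube under an injective continuous map, so by invariance of domain it
  has interior points, and on a convex body a nonnegative continuous function that is positive
  somewhere has positive integral (\<open>integral_pos_convex_body\<close>). Nonnegativity of \<open>f_approx\<close>
  follows. For the integral, \<open>C_coeff \<Gamma> \<phi> j\<close> cancels against the denominator of
  \<open>F_coeff \<Gamma> \<phi> M Y j\<close>, which leaves
  \<open>(1 / M) * (\<Sum>j. \<Sum>m. \<phi> j (Y m)) = (1 / M) * (\<Sum>m. 1) = 1\<close>.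
\<close>

section \<open>Interpolation on the reference cube\<close>

text \<open>The vertex of the reference cube whose coordinates in \<open>A\<close> are 1 and whose others are 0.\<close>

definition cube_vertex :: "'n set \<Rightarrow> real^'n" where
  "cube_vertex A = (\<chi> i. if i \<in> A then 1 else 0)"

text \<open>
  The multilinear Lagrange function of the vertex \<open>A\<close> on the reference cube; it is the coefficient
  of \<open>v A\<close> in \<^term>\<open>ref_map v t\<close>.
\<close>

definition vertex_weight :: "'n set \<Rightarrow> real^'n \<Rightarrow> real" where
  "vertex_weight A t = (\<Prod>i\<in>A. t $ i) * (\<Prod>i\<in>-A. 1 - t $ i)"

lemma ref_map_eq: "ref_map v t = (\<Sum>A\<in>UNIV. vertex_weight A t *\<^sub>R v A)"
  by (simp add: ref_map_def vertex_weight_def)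

lemma cube_vertex_in_cube: "cube_vertex A \<in> cbox 0 1"
  by (simp add: cube_vertex_def mem_box_cart)

lemma vertex_weight_cube_vertex:
  fixes A B :: "'n::finite set"
  shows "vertex_weight A (cube_vertex B) = (if A = B then 1 else 0)"
proof (cases "A = B")
  case True
  then show ?thesis
    by (simp add: vertex_weight_def cube_vertex_def)
next
  case False
  then consider i where "i \<in> A" "i \<notin> B" | i where "i \<in> B" "i \<notin> A"
    by blast
  then show ?thesis
    using False by cases (auto simp: vertex_weight_def cube_vertex_def)
qed

lemma vertex_weight_nonneg:
  assumes "t \<in> cbox 0 1"
  shows "vertex_weight A t \<ge> 0"
  using assms unfolding vertex_weight_def
  by (intro mult_nonneg_nonneg prod_nonneg) (auto simp: mem_box_cart)

lemma ref_map_cube_vertex: "ref_map v (cube_vertex A) = v A"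
proof -
  have "ref_map v (cube_vertex A) = (\<Sum>B\<in>UNIV. if B = A then v B else 0)"
    unfolding ref_map_eq by (rule sum.cong) (auto simp: vertex_weight_cube_vertex)
  then show ?thesis
    by simp
qed

lemma monomial_interpolation:
  fixes t :: "real^'n"
  shows "(\<Prod>i\<in>S. t $ i) = (\<Sum>A\<in>UNIV. vertex_weight A t * (\<Prod>i\<in>S. cube_vertex A $ i))"
proof -
  \<comment> \<open>Each factor is written as a sum of two terms, and the product of these sums is expanded.\<close>
  define g where "g i = (if i \<in> S then 0 else 1 - t $ i)" for i
  have "(\<Prod>i\<in>S. t $ i) = (\<Prod>i\<in>UNIV. if i \<in> S then t $ i else 1)"
    by (simp add: prod.If_cases)
  also have "\<dots> = (\<Prod>i\<in>UNIV. t $ i + g i)"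
    by (rule prod.cong) (auto simp: g_def)
  also have "\<dots> = (\<Sum>A\<in>UNIV. (\<Prod>i\<in>A. t $ i) * (\<Prod>i\<in>-A. g i))"
    by (simp add: prod_add Compl_eq_Diff_UNIV)
  also have "\<dots> = (\<Sum>A\<in>UNIV. vertex_weight A t * (\<Prod>i\<in>S. cube_vertex A $ i))"
  proof (rule sum.cong)
    fix A :: "'n set"
    show "(\<Prod>i\<in>A. t $ i) * (\<Prod>i\<in>-A. g i) = vertex_weight A t * (\<Prod>i\<in>S. cube_vertex A $ i)"
    proof (cases "S \<subseteq> A")
      case True
      then have "(\<Prod>i\<in>-A. g i) = (\<Prod>i\<in>-A. 1 - t $ i)" "(\<Prod>i\<in>S. cube_vertex A $ i) = 1"
        by (auto simp: g_def cube_vertex_def intro!: prod.cong prod.neutral)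
      then show ?thesis
        by (simp add: vertex_weight_def)
    next
      case False
      then obtain k where "k \<in> S" "k \<notin> A"
        by blast
      then have "(\<Prod>i\<in>-A. g i) = 0" "(\<Prod>i\<in>S. cube_vertex A $ i) = 0"
        by (force simp: g_def cube_vertex_def)+
      then show ?thesis
        by (simp only: mult_zero_right)
    qed
  qed simp
  finally show ?thesis .
qed

lemma sum_vertex_weight: "(\<Sum>A\<in>UNIV. vertex_weight A t) = 1"
  using monomial_interpolation[of t "{}"] by simp

lemma multilinear_poly_interpolation:
  assumes "multilinear_poly q"
  shows "q t = (\<Sum>A\<in>UNIV. vertex_weight A t * q (cube_vertex A))"
proof -
  obtain c where c: "\<And>t. q t = (\<Sum>S\<in>UNIV. c S * (\<Prod>i\<in>S. t $ i))"
    using assms unfolding multilinear_poly_def by blast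
  have "q t = (\<Sum>S\<in>UNIV. \<Sum>A\<in>UNIV.
      vertex_weight A t * (c S * (\<Prod>i\<in>S. cube_vertex A $ i)))"
    unfolding c by (subst monomial_interpolation) (simp add: sum_distrib_left mult_ac)
  also have "\<dots> = (\<Sum>A\<in>UNIV. vertex_weight A t * q (cube_vertex A))"
    unfolding c by (subst sum.swap) (simp add: sum_distrib_left)
  finally show ?thesis .
qed

section \<open>Bins and hat functions\<close>

lemma continuous_on_ref_map: "continuous_on S (ref_map v)"
  unfolding ref_map_def by (intro continuous_intros)

lemma interior_bin_nonempty:
  assumes "hyper_quadrilateral v"
  shows "interior (bin v) \<noteq> {}"
proof -
  let ?U = "box 0 1 :: (real^'a) set"
  have "inj_on (ref_map v) ?U"
    using assms box_subset_cbox unfolding hyper_quadrilateral_def by (rule inj_on_subset)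
  then have "open (ref_map v ` ?U)"
    by (intro invariance_of_domain continuous_on_ref_map open_box)
  moreover have "ref_map v ` ?U \<subseteq> bin v"
    using box_subset_cbox unfolding bin_def by (rule image_mono)
  moreover have "?U \<noteq> {}"
    by (simp add: box_ne_empty inner_Basis_inf_left one_vec_def Basis_vec_def inner_axis)
  ultimately show ?thesis
    by (metis image_is_empty interior_maximal subset_empty)
qed

text \<open>
  The values at a given point of all functions of the finite element space are obtained from the
  vertex values by one and the same convex combination.
\<close>

lemma fe_space_eq_vertex_combination:
  assumes "bin_subdivision \<Gamma> Nbins B" and "y \<in> \<Gamma>"
  obtains l w where "l \<in> {1..Nbins}" and "\<And>A. w A \<ge> 0" and "(\<Sum>A\<in>UNIV. w A) = (1::real)"
    and "\<And>f. f \<in> fe_space \<Gamma> Nbins B \<Longrightarrow> f y = (\<Sum>A\<in>UNIV. w A * f (B l A))"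
proof -
  obtain l t where l: "l \<in> {1..Nbins}" and t: "t \<in> cbox 0 1" and y: "y = ref_map (B l) t"
    using assms unfolding bin_subdivision_def bin_def by blast
  have "f y = (\<Sum>A\<in>UNIV. vertex_weight A t * f (B l A))" if f: "f \<in> fe_space \<Gamma> Nbins B" for f
  proof -
    obtain q where q: "multilinear_poly q" and eq: "\<And>s. s \<in> cbox 0 1 \<Longrightarrow> f (ref_map (B l) s) = q s"
      using f l unfolding fe_space_def by blast
    have "q (cube_vertex A) = f (B l A)" for A
      using eq[OF cube_vertex_in_cube] by (simp add: ref_map_cube_vertex)
    then show ?thesis
      using multilinear_poly_interpolation[OF q, of t] eq[OF t] y by simp
  qed
  then show thesis
    by (rule that[OF l vertex_weight_nonneg[OF t] sum_vertex_weight])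
qed

context
  fixes \<Gamma> :: "(real^'n) set" and B :: "nat \<Rightarrow> 'n set \<Rightarrow> real^'n" and Yhat :: "nat \<Rightarrow> real^'n"
    and \<phi> :: "nat \<Rightarrow> real^'n \<Rightarrow> real" and Nbins Nnodes :: nat
  assumes subdivision: "bin_subdivision \<Gamma> Nbins B"
    and Yhat: "bij_betw Yhat {1..Nnodes} (nodes Nbins B)"
    and basis: "lagrangian_basis \<Gamma> Nbins B Nnodes Yhat \<phi>"
begin

lemma hat_in_fe_space: "j \<in> {1..Nnodes} \<Longrightarrow> \<phi> j \<in> fe_space \<Gamma> Nbins B"
  using basis by (simp add: lagrangian_basis_def)

lemma hat_at_node:
  "j \<in> {1..Nnodes} \<Longrightarrow> k \<in> {1..Nnodes} \<Longrightarrow> \<phi> j (Yhat k) = (if j = k then 1 else 0)"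
  using basis by (simp add: lagrangian_basis_def)

lemma vertex_is_node:
  assumes "l \<in> {1..Nbins}"
  obtains k where "k \<in> {1..Nnodes}" and "B l A = Yhat k"
proof -
  have "B l A \<in> Yhat ` {1..Nnodes}"
    using assms unfolding bij_betw_imp_surj_on[OF Yhat] nodes_def by blast
  then show thesis
    using that by blast
qed

lemma node_in_domain:
  assumes "j \<in> {1..Nnodes}"
  shows "Yhat j \<in> \<Gamma>"
proof -
  obtain l A where l: "l \<in> {1..Nbins}" and "Yhat j = B l A"
    using bij_betwE[OF Yhat] assms unfolding nodes_def by blast
  then have "Yhat j \<in> bin (B l)"
    unfolding bin_def by (metis cube_vertex_in_cube imageI ref_map_cube_vertex)
  then show ?thesis
    using subdivision l unfolding bin_subdivision_def by blast
qed

lemma hat_nonneg: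
  assumes "j \<in> {1..Nnodes}" and "y \<in> \<Gamma>"
  shows "\<phi> j y \<ge> 0"
proof -
  obtain l w where l: "l \<in> {1..Nbins}" and w: "\<And>A. w A \<ge> 0" and "(\<Sum>A\<in>UNIV. w A) = (1::real)"
    and eq: "\<And>f. f \<in> fe_space \<Gamma> Nbins B \<Longrightarrow> f y = (\<Sum>A\<in>UNIV. w A * f (B l A))"
    by (rule fe_space_eq_vertex_combination[OF subdivision assms(2)]) (rule that)
  have "\<phi> j (B l A) \<ge> 0" for A
  proof -
    obtain k where "k \<in> {1..Nnodes}" "B l A = Yhat k"
      using vertex_is_node[OF l] .
    then show ?thesis
      using hat_at_node[OF assms(1)] by simp
  qed
  then show ?thesis
    unfolding eq[OF hat_in_fe_space[OF assms(1)]] by (intro sum_nonneg mult_nonneg_nonneg w)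
qed

lemma sum_hat_eq_1:
  assumes "y \<in> \<Gamma>"
  shows "(\<Sum>j\<in>{1..Nnodes}. \<phi> j y) = 1"
proof -
  obtain l w where l: "l \<in> {1..Nbins}" and "\<And>A. w A \<ge> 0" and w: "(\<Sum>A\<in>UNIV. w A) = (1::real)"
    and eq: "\<And>f. f \<in> fe_space \<Gamma> Nbins B \<Longrightarrow> f y = (\<Sum>A\<in>UNIV. w A * f (B l A))"
    by (rule fe_space_eq_vertex_combination[OF subdivision assms]) (rule that)
  have vertex: "(\<Sum>j\<in>{1..Nnodes}. \<phi> j (B l A)) = 1" for A
  proof -
    obtain k where k: "k \<in> {1..Nnodes}" "B l A = Yhat k"
      using vertex_is_node[OF l] .
    have "(\<Sum>j\<in>{1..Nnodes}. \<phi> j (B l A)) = (\<Sum>j\<in>{1..Nnodes}. if j = k then 1 else 0)"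
      using k by (intro sum.cong) (simp_all add: hat_at_node)
    then show ?thesis
      using k by simp
  qed
  have "(\<Sum>j\<in>{1..Nnodes}. \<phi> j y) = (\<Sum>j\<in>{1..Nnodes}. \<Sum>A\<in>UNIV. w A * \<phi> j (B l A))"
    by (intro sum.cong refl eq hat_in_fe_space)
  also have "\<dots> = (\<Sum>A\<in>UNIV. w A * (\<Sum>j\<in>{1..Nnodes}. \<phi> j (B l A)))"
    by (subst sum.swap) (simp add: sum_distrib_left)
  finally show ?thesis
    using vertex w by simp
qed

end

section \<open>Integrals of hat functions\<close>

lemma integral_pos_convex_body:
  fixes f :: "'a::euclidean_space \<Rightarrow> real"
  assumes "compact S" "convex S" and int: "interior S \<noteq> {}" and cont: "continuous_on S f"
    and nonneg: "\<And>x. x \<in> S \<Longrightarrow> f x \<ge> 0" and "a \<in> S" "f a > 0"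
  shows "(LINT x:S|lborel. f x) > 0"
proof (rule ccontr)
  assume "\<not> ?thesis"
  moreover have "(LINT x:S|lborel. f x) \<ge> 0"
    using nonneg unfolding set_lebesgue_integral_def
    by (intro Bochner_Integration.integral_nonneg) (auto simp: indicator_def)
  ultimately have zero: "(LINT x:S|lborel. f x) = 0"
    by simp
  have si: "set_integrable lborel S f"
    unfolding set_integrable_def using \<open>compact S\<close> cont by (rule borel_integrable_compact)
  have hk: "(f has_integral 0) S"
    using integrable_integral[OF set_borel_integral_eq_integral(1)[OF si]] zero
    by (simp add: set_borel_integral_eq_integral(2)[OF si])
  have cl: "closure (interior S) = S"
    using convex_closure_interior[OF \<open>convex S\<close> int] \<open>compact S\<close>
    by (simp add: compact_imp_closed closure_closed)
  have "frontier S \<in> null_sets lborel"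
    using negligible_convex_frontier[OF \<open>convex S\<close>]
    by (simp add: null_sets_completion_iff negligible_iff_null_sets)
  then have "emeasure lborel (interior S \<union> frontier S) = emeasure lborel (interior S)"
    by (intro emeasure_Un_null_set) auto
  moreover have "interior S \<union> frontier S = S"
    using closure_Un_frontier[of "interior S"] closure_closed[OF compact_imp_closed[OF \<open>compact S\<close>]]
      interior_subset[of S] unfolding frontier_def by blast
  ultimately have regular: "emeasure lborel S = emeasure lborel (interior S)"
    by simp
  have "interior S \<notin> null_sets lborel"
    using open_not_negligible[OF open_interior int]
    by (simp add: negligible_iff_null_sets null_sets_completion_iff)
  then have pos: "emeasure lborel (interior S) > 0"
    by (auto simp: null_sets_def zero_less_iff_neq_zero)
  have fin: "emeasure lborel (interior S) < \<infinity>"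
    by (intro emeasure_bounded_finite bounded_interior compact_imp_bounded \<open>compact S\<close>)
  have "f x \<ge> 0" if "x \<in> interior S" for x
    using nonneg that interior_subset by blast
  then have "f a = 0"
    using has_integral_0_closure_imp_0[of "interior S" f a, unfolded cl,
        OF cont _ pos fin regular open_interior hk \<open>a \<in> S\<close>] by blast
  then show False
    using \<open>f a > 0\<close> by simp
qed

lemma mem_supp: "y \<in> \<Gamma> \<Longrightarrow> f y \<noteq> 0 \<Longrightarrow> y \<in> supp \<Gamma> f"
  unfolding supp_def by (rule subsetD[OF closure_subset]) simp

lemma C_coeff_eq_integral:
  assumes "closed \<Gamma>"
  shows "C_coeff \<Gamma> \<phi> j = (LINT y:\<Gamma>|lborel. \<phi> j y)"
proof -
  have "supp \<Gamma> (\<phi> j) \<subseteq> \<Gamma>"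
    unfolding supp_def using assms by (intro closure_minimal) auto
  then have "indicator (supp \<Gamma> (\<phi> j)) y *\<^sub>R \<phi> j y = indicator \<Gamma> y *\<^sub>R \<phi> j y" for y
    using mem_supp[of y \<Gamma> "\<phi> j"] by (cases "y \<in> \<Gamma>"; cases "\<phi> j y = 0") (auto simp: indicator_def)
  then show ?thesis
    unfolding C_coeff_def set_lebesgue_integral_def by (rule Bochner_Integration.integral_cong[OF refl])
qed

text \<open>Samples in \<open>\<Gamma>\<close> outside the support of \<open>\<phi> j\<close> contribute nothing to \<open>F_coeff \<Gamma> \<phi> M Y j\<close>.\<close>

lemma F_coeff_eq:
  assumes "\<forall>m\<in>{1..M}. Y m \<in> \<Gamma>"
  shows "F_coeff \<Gamma> \<phi> M Y j = (\<Sum>m\<in>{1..M}. \<phi> j (Y m)) / (real M * C_coeff \<Gamma> \<phi> j)"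
proof -
  have "(\<Sum>m | m \<in> {1..M} \<and> Y m \<in> supp \<Gamma> (\<phi> j). \<phi> j (Y m)) = (\<Sum>m\<in>{1..M}. \<phi> j (Y m))"
  proof (rule sum.mono_neutral_left)
    show "\<forall>m\<in>{1..M} - {m. m \<in> {1..M} \<and> Y m \<in> supp \<Gamma> (\<phi> j)}. \<phi> j (Y m) = 0"
      using assms mem_supp by blast
  qed auto
  then show ?thesis
    by (simp add: F_coeff_def)
qed

theorem lemma1:
  fixes \<Gamma> :: "(real^'n) set"
    and B :: "nat \<Rightarrow> 'n set \<Rightarrow> real^'n"
    and Yhat Y :: "nat \<Rightarrow> real^'n"
    and \<phi> :: "nat \<Rightarrow> real^'n \<Rightarrow> real"
    and Nbins Nnodes M :: nat
  assumes "polytope \<Gamma>"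
    and "bin_subdivision \<Gamma> Nbins B"
    and "bij_betw Yhat {1..Nnodes} (nodes Nbins B)"
    and "lagrangian_basis \<Gamma> Nbins B Nnodes Yhat \<phi>"
    and "M \<ge> 1"
    and "\<forall>m\<in>{1..M}. Y m \<in> \<Gamma>"
  shows "(\<forall>y\<in>\<Gamma>. f_approx \<Gamma> Nnodes \<phi> M Y y \<ge> 0) \<and>
         (LINT y:\<Gamma>|lborel. f_approx \<Gamma> Nnodes \<phi> M Y y) = 1"
proof -
  have compact: "compact \<Gamma>" and convex: "convex \<Gamma>"
    using assms(1) by (simp_all add: polytope_imp_compact polytope_imp_convex)
  note nonneg = hat_nonneg[OF assms(2-4)]
  \<comment> \<open>The sample \<open>Y 1\<close> shows that \<open>\<Gamma>\<close> is not empty, so there is at least one bin.\<close>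
  have "Y 1 \<in> \<Gamma>"
    using assms(5,6) by simp
  then obtain l where l: "l \<in> {1..Nbins}"
    using assms(2) unfolding bin_subdivision_def by blast
  then have "bin (B l) \<subseteq> \<Gamma>" "hyper_quadrilateral (B l)"
    using assms(2) unfolding bin_subdivision_def by blast+
  then have int: "interior \<Gamma> \<noteq> {}"
    using interior_bin_nonempty interior_mono by blast
  have cont: "continuous_on \<Gamma> (\<phi> j)" if "j \<in> {1..Nnodes}" for j
    using hat_in_fe_space[OF assms(2-4) that] by (simp add: fe_space_def)
  have C_eq: "C_coeff \<Gamma> \<phi> j = (LINT y:\<Gamma>|lborel. \<phi> j y)" for j
    by (intro C_coeff_eq_integral compact_imp_closed compact)
  have C_pos: "C_coeff \<Gamma> \<phi> j > 0" if j: "j \<in> {1..Nnodes}" for j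
    unfolding C_eq
    using node_in_domain[OF assms(2-4) j] hat_at_node[OF assms(2-4) j j]
    by (intro integral_pos_convex_body[OF compact convex int cont[OF j] nonneg[OF j]]) auto
  have F_nonneg: "F_coeff \<Gamma> \<phi> M Y j \<ge> 0" if j: "j \<in> {1..Nnodes}" for j
    unfolding F_coeff_eq[OF assms(6)] using C_pos[OF j] nonneg[OF j] assms(6)
    by (intro divide_nonneg_nonneg sum_nonneg mult_nonneg_nonneg) auto
  have "f_approx \<Gamma> Nnodes \<phi> M Y y \<ge> 0" if "y \<in> \<Gamma>" for y
    unfolding f_approx_def using F_nonneg nonneg that by (intro sum_nonneg mult_nonneg_nonneg)
  moreover have "(LINT y:\<Gamma>|lborel. f_approx \<Gamma> Nnodes \<phi> M Y y) = 1"
  proof -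
    have "integrable lborel (\<lambda>y. indicator \<Gamma> y *\<^sub>R (F_coeff \<Gamma> \<phi> M Y j * \<phi> j y))"
      if "j \<in> {1..Nnodes}" for j
      using cont[OF that] by (intro borel_integrable_compact compact continuous_intros)
    then have "(LINT y:\<Gamma>|lborel. f_approx \<Gamma> Nnodes \<phi> M Y y)
        = (\<Sum>j\<in>{1..Nnodes}. LINT y:\<Gamma>|lborel. F_coeff \<Gamma> \<phi> M Y j * \<phi> j y)"
      unfolding f_approx_def set_lebesgue_integral_def
      by (simp only: scaleR_sum_right Bochner_Integration.integral_sum)
    also have "\<dots> = (\<Sum>j\<in>{1..Nnodes}. F_coeff \<Gamma> \<phi> M Y j * C_coeff \<Gamma> \<phi> j)"
      by (simp add: C_eq)
    also have "\<dots> = (\<Sum>j\<in>{1..Nnodes}. (\<Sum>m\<in>{1..M}. \<phi> j (Y m)) / real M)"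
    proof (intro sum.cong refl)
      fix j assume "j \<in> {1..Nnodes}"
      then show "F_coeff \<Gamma> \<phi> M Y j * C_coeff \<Gamma> \<phi> j = (\<Sum>m\<in>{1..M}. \<phi> j (Y m)) / real M"
        using C_pos[of j] unfolding F_coeff_eq[OF assms(6)] by simp
    qed
    also have "\<dots> = (\<Sum>m\<in>{1..M}. \<Sum>j\<in>{1..Nnodes}. \<phi> j (Y m)) / real M"
      by (subst sum.swap) (simp add: sum_divide_distrib)
    also have "\<dots> = (\<Sum>m\<in>{1..M}. 1) / real M"
      using sum_hat_eq_1[OF assms(2-4)] assms(6) by simp
    also have "\<dots> = 1"
      using assms(5) by simp
    finally show ?thesis .
  qed
  ultimately show ?thesis
    by blast
qed

end
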